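(* Let $0<H<1$, let $\sigma>0$ and $Z_0>0$ be constants, and let $(W_t^H)_{t\ge 0}$ be a fractional Brownian motion with Hurst parameter $H$. Let $f:[0,\infty)\times[0,\infty)\to(-\infty,\infty)$ be a continuous function satisfying condition (D1) (stated in the context). Then the equation $$dZ_t=\frac{f(t,Z_t)}{2Z_t}\,dt+\frac{\sigma}{2}\,dW_t^H$$ with initial value $Z_0$ has a unique solution $(Z_t)_{t\ge 0}$ which is continuous and positive up to the time of the first visit to $0$.
   Context: Condition (D1) on $f$: the function $g:[0,\infty)\times(0,\infty)\to(-\infty,\infty)$ defined by $g(t,x)=f(t,x)/(2x)$ is continuous and admits a continuous partial derivative with respect to $x$ on $(0,\infty)$; in addition, there exists a number $x^*>0$ such that for every $x>x^*$, $g(t,x)<0$ for all $t\ge 0$. The fractional Brownian motion $(W_t^H)_{t\ge0}$ is defined on a probability space $(\Omega,\mathcal F,\mathbb P)$, starts at $W_0^H=0$, and has almost surely continuous sample paths. The stochastic differential equation is understood pathwise in integral form: almost surely, $$Z_t=Z_0+\frac12\int_0^t f(s,Z_s)Z_s^{-1}\,ds+\frac{\sigma}{2}W_t^H$$ for all $0\le t<\tau$, where $\tau=\inf\{t>0: Z_t=0\}$ (with $\inf\emptyset=+\infty$) is the time of the first visit to $0$. Uniqueness is of the solution, started at $Z_0$, up to this time. *)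

theory Defs
  imports "HOL-Probability.Probability"
begin

text \<open>Gaussian laws include the degenerate ones (point masses), so that constants such as
  the value of a process at time \<open>0\<close> are Gaussian.\<close>

definition gaussian_rv :: "'a measure \<Rightarrow> ('a \<Rightarrow> real) \<Rightarrow> bool" where
  "gaussian_rv M X \<longleftrightarrow> X \<in> borel_measurable M \<and>
     (\<exists>\<mu> s. (s > 0 \<and> distributed M lborel X (\<lambda>x. ennreal (normal_density \<mu> s x))) \<or>
            (AE \<omega> in M. X \<omega> = \<mu>))"

definition gaussian_process :: "'a measure \<Rightarrow> real set \<Rightarrow> (real \<Rightarrow> 'a \<Rightarrow> real) \<Rightarrow> bool" where
  "gaussian_process M T X \<longleftrightarrow>
     (\<forall>I c. finite I \<longrightarrow> I \<subseteq> T \<longrightarrow> gaussian_rv M (\<lambda>\<omega>. \<Sum>t\<in>I. c t * X t \<omega>))"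

definition fractional_brownian_motion ::
    "'a measure \<Rightarrow> real \<Rightarrow> (real \<Rightarrow> 'a \<Rightarrow> real) \<Rightarrow> bool" where
  "fractional_brownian_motion M H W \<longleftrightarrow>
     gaussian_process M {0..} W \<and>
     (\<forall>t\<ge>0. prob_space.expectation M (W t) = 0) \<and>
     (\<forall>s\<ge>0. \<forall>t\<ge>0. prob_space.expectation M (\<lambda>\<omega>. W s \<omega> * W t \<omega>) =
        (s powr (2 * H) + t powr (2 * H) - \<bar>t - s\<bar> powr (2 * H)) / 2) \<and>
     (AE \<omega> in M. W 0 \<omega> = 0) \<and>
     (AE \<omega> in M. continuous_on {0..} (\<lambda>t. W t \<omega>))"

text \<open>The partial derivative in \<open>x\<close> is required to be jointly continuous in \<open>(t, x)\<close>.\<close>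

definition condition_D1 :: "(real \<Rightarrow> real \<Rightarrow> real) \<Rightarrow> bool" where
  "condition_D1 f \<longleftrightarrow>
     (let g = (\<lambda>t x. f t x / (2 * x)) in
        continuous_on ({0..} \<times> {0<..}) (\<lambda>(t, x). g t x) \<and>
        (\<exists>g'. (\<forall>t\<ge>0. \<forall>x>0. ((\<lambda>y. g t y) has_real_derivative g' t x) (at x)) \<and>
              continuous_on ({0..} \<times> {0<..}) (\<lambda>(t, x). g' t x)) \<and>
        (\<exists>x0>0. \<forall>x>x0. \<forall>t\<ge>0. g t x < 0))"

definition first_visit :: "(real \<Rightarrow> real) \<Rightarrow> ereal" where
  "first_visit z = Inf (ereal ` {t. t > 0 \<and> z t = 0})"

text \<open>A path \<open>z\<close> driven by the path \<open>w\<close> is considered only on \<open>[0, \<tau>]\<close>, where \<open>\<tau>\<close> is its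
  first visit to \<open>0\<close>; its values after \<open>\<tau>\<close> are irrelevant. If \<open>\<tau>\<close> is finite, the path must
  reach \<open>0\<close> continuously at \<open>\<tau>\<close>: otherwise a path could be stopped at an arbitrary time by
  letting it jump to \<open>0\<close>, and no uniqueness could hold.\<close>

definition solution_path ::
    "(real \<Rightarrow> real \<Rightarrow> real) \<Rightarrow> real \<Rightarrow> real \<Rightarrow> (real \<Rightarrow> real) \<Rightarrow> (real \<Rightarrow> real) \<Rightarrow> bool" where
  "solution_path f \<sigma> z0 w z \<longleftrightarrow>
     z 0 = z0 \<and>
     continuous_on {t. 0 \<le> t \<and> ereal t \<le> first_visit z} z \<and>
     (\<forall>t. ereal t = first_visit z \<longrightarrow> z t = 0) \<and>
     (\<forall>t. 0 \<le> t \<and> ereal t < first_visit z \<longrightarrow>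
        set_integrable lborel {0..t} (\<lambda>s. f s (z s) / z s) \<and>
        z t = z0 + (1/2) * (LINT s:{0..t}|lborel. f s (z s) / z s) + (\<sigma>/2) * w t)"

definition sde_solution ::
    "'a measure \<Rightarrow> (real \<Rightarrow> real \<Rightarrow> real) \<Rightarrow> real \<Rightarrow> real \<Rightarrow> (real \<Rightarrow> 'a \<Rightarrow> real) \<Rightarrow>
      (real \<Rightarrow> 'a \<Rightarrow> real) \<Rightarrow> bool" where
  "sde_solution M f \<sigma> z0 W Z \<longleftrightarrow>
     (\<forall>t\<ge>0. Z t \<in> borel_measurable M) \<and>
     (AE \<omega> in M. solution_path f \<sigma> z0 (\<lambda>t. W t \<omega>) (\<lambda>t. Z t \<omega>))"

end

theory Submission imports Defs begin

text \<open>
The noise is additive, so the equation can be solved separately for each continuous path of the driving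
process: with \<open>b t = z0 + \<sigma> / 2 * W t\<close> and \<open>g t x = f t x / (2 * x)\<close> it is the integral equation
\<open>z t = b t + integral {0..t} (\<lambda>s. g s (z s))\<close>.

By condition (D1) the drift \<open>g\<close> is Lipschitz in \<open>x\<close> on compact subsets of the open half-line. Clamping
\<open>x\<close> to the window \<open>[1/(n+1), n+1]\<close> gives a globally Lipschitz drift, whose equation has a unique
solution for all times by Picard iteration (\<open>flow_equation\<close>, \<open>flow_unique\<close>). As long as this solution
stays in the window it solves the original equation, and by uniqueness the solutions for different \<open>n\<close>
agree there. They are glued to one maximal positive solution, continued by \<open>0\<close> (\<open>glued_eq\<close>,
\<open>glued_eq_0\<close>).

The end \<open>\<tau>\<close> of the life time of the maximal solution is its first visit to \<open>0\<close>. Since \<open>g\<close> is negative for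
large \<open>x\<close>, the solution is bounded on bounded time intervals (\<open>solves_upper_bound\<close>), so at a finite \<open>\<tau>\<close>
it can only break down at \<open>0\<close>; that it converges to \<open>0\<close> instead of oscillating follows because
crossing a strip away from \<open>0\<close> takes a minimal time (\<open>glued_tendsto_0\<close>). Uniqueness up to \<open>\<tau>\<close> follows
from the uniqueness for the truncated equations (\<open>solution_path_unique\<close>).

It remains that the solution is a random variable at each time. Picard iterates are built from time
integrals of continuous processes, which are measurable, and the gluing uses only limits and events that
are determined by countably many times (\<open>borel_measurable_glued\<close>).
\<close>

section \<open>Integral equations with Lipschitz drift\<close>

locale lipschitz_drift =
  fixes h :: "real \<Rightarrow> real \<Rightarrow> real"
  assumes continuous: "continuous_on ({0..} \<times> UNIV) (\<lambda>(t, x). h t x)"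
    and lipschitz: "\<And>T. \<exists>L>0. \<forall>t\<in>{0..T}. \<forall>x y. \<bar>h t x - h t y\<bar> \<le> L * \<bar>x - y\<bar>"
begin

lemma continuous_on_drift:
  assumes "continuous_on {0..T} x"
  shows "continuous_on {0..T} (\<lambda>s. h s (x s))"
proof -
  have "continuous_on {0..T} (\<lambda>s. (\<lambda>(t, x). h t x) (s, x s))"
    using assms by (intro continuous_on_compose2[OF continuous]) (auto intro!: continuous_intros)
  then show ?thesis by simp
qed

lemma integrable_drift:
  assumes "continuous_on {0..T} x"
  shows "(\<lambda>s. h s (x s)) integrable_on {0..T}"
  using continuous_on_drift[OF assms] by (rule integrable_continuous_real)

lemma continuous_on_drift_integral:
  assumes "continuous_on {0..T} x"
  shows "continuous_on {0..T} (\<lambda>t. integral {0..t} (\<lambda>s. h s (x s)))"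
  using integrable_drift[OF assms] by (rule indefinite_integral_continuous_1)

text \<open>For distances weighted by \<open>exp (2 * L * t)\<close> the drift integral is a contraction with factor
\<open>1/2\<close>, because \<open>L\<close> times the integral of that weight is at most half the weight itself. This one
estimate gives both the convergence of the Picard iterates on arbitrarily long intervals and
uniqueness.\<close>

lemma drift_integral_contraction:
  assumes "0 \<le> t" "0 < L" "0 \<le> C"
    and x: "continuous_on {0..t} x" and y: "continuous_on {0..t} y"
    and lip: "\<And>s x y. s \<in> {0..t} \<Longrightarrow> \<bar>h s x - h s y\<bar> \<le> L * \<bar>x - y\<bar>"
    and dist: "\<And>s. s \<in> {0..t} \<Longrightarrow> \<bar>x s - y s\<bar> \<le> C * exp (2 * L * s)"
  shows "\<bar>integral {0..t} (\<lambda>s. h s (x s)) - integral {0..t} (\<lambda>s. h s (y s))\<bar>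
           \<le> C / 2 * exp (2 * L * t)"
proof -
  have I: "((\<lambda>s. L * (C * exp (2 * L * s))) has_integral
              C / 2 * exp (2 * L * t) - C / 2 * exp (2 * L * 0)) {0..t}"
  proof (rule fundamental_theorem_of_calculus)
    fix s
    show "((\<lambda>s. C / 2 * exp (2 * L * s)) has_vector_derivative L * (C * exp (2 * L * s)))
            (at s within {0..t})"
      by (rule has_vector_derivative_at_within)
        (auto simp flip: has_real_derivative_iff_has_vector_derivative
              intro!: derivative_eq_intros)
  qed (use assms in auto)
  have "\<bar>integral {0..t} (\<lambda>s. h s (x s)) - integral {0..t} (\<lambda>s. h s (y s))\<bar>
          = \<bar>integral {0..t} (\<lambda>s. h s (x s) - h s (y s))\<bar>"
    using integrable_drift x y by (simp add: integral_diff)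
  also have "\<dots> \<le> integral {0..t} (\<lambda>s. L * (C * exp (2 * L * s)))"
    unfolding real_norm_def[symmetric]
  proof (rule integral_norm_bound_integral)
    fix s assume s: "s \<in> {0..t}"
    have "\<bar>h s (x s) - h s (y s)\<bar> \<le> L * \<bar>x s - y s\<bar>" using lip[OF s] .
    also have "\<dots> \<le> L * (C * exp (2 * L * s))"
      using dist[OF s] assms by (intro mult_left_mono) auto
    finally show "norm (h s (x s) - h s (y s)) \<le> L * (C * exp (2 * L * s))" by simp
  qed (use integrable_drift x y I in \<open>auto intro: integrable_diff\<close>)
  also have "\<dots> = C / 2 * exp (2 * L * t) - C / 2"
    unfolding integral_unique[OF I] by simp
  finally show ?thesis using assms by simp
qed

text \<open>The driving path \<open>b\<close> contains the initial value and the noise, so the integral equation is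
\<open>x t = b t + integral {0..t} (\<lambda>s. h s (x s))\<close>. Its solution is defined as a pointwise limit of
iterates, rather than chosen from an existence statement, because this makes it a measurable function
of a random driving path.\<close>

primrec picard :: "(real \<Rightarrow> real) \<Rightarrow> nat \<Rightarrow> real \<Rightarrow> real" where
  "picard b 0 = b"
| "picard b (Suc k) = (\<lambda>t. b t + integral {0..t} (\<lambda>s. h s (picard b k s)))"

definition flow :: "(real \<Rightarrow> real) \<Rightarrow> real \<Rightarrow> real" where
  "flow b t = lim (\<lambda>k. picard b k t)"

lemma continuous_on_picard:
  assumes "continuous_on {0..T} b"
  shows "continuous_on {0..T} (picard b k)"
  using assms
  by (induction k) (auto intro!: continuous_intros continuous_on_drift_integral)

lemma uniform_limit_picard:
  assumes b: "continuous_on {0..T} b"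
  shows "uniform_limit {0..T} (picard b) (flow b) sequentially"
proof -
  obtain L where L: "L > 0"
    and lip: "\<And>s x y. s \<in> {0..T} \<Longrightarrow> \<bar>h s x - h s y\<bar> \<le> L * \<bar>x - y\<bar>"
    using lipschitz by meson
  have cont: "continuous_on {0..T} (\<lambda>t. picard b 1 t - picard b 0 t)"
    using continuous_on_picard[OF b] by (intro continuous_intros)
  have "bounded ((\<lambda>t. picard b 1 t - picard b 0 t) ` {0..T})"
    using compact_continuous_image[OF cont] by (intro compact_imp_bounded) simp
  then obtain C where "C > 0" and C: "\<And>t. t \<in> {0..T} \<Longrightarrow> \<bar>picard b 1 t - picard b 0 t\<bar> \<le> C"
    unfolding bounded_pos by auto
  have step: "\<bar>picard b (Suc k) t - picard b k t\<bar> \<le> C / 2 ^ k * exp (2 * L * t)"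
    if "t \<in> {0..T}" for k t
    using that
  proof (induction k arbitrary: t)
    case 0
    have "C * 1 \<le> C * exp (2 * L * t)"
      using 0 L \<open>C > 0\<close> by (intro mult_left_mono) auto
    with C[OF 0] show ?case by simp
  next
    case (Suc k)
    have sub: "{0..t} \<subseteq> {0..T}" using Suc.prems by auto
    have "\<bar>integral {0..t} (\<lambda>s. h s (picard b (Suc k) s)) - integral {0..t} (\<lambda>s. h s (picard b k s))\<bar>
            \<le> C / 2 ^ k / 2 * exp (2 * L * t)"
      using Suc.prems L \<open>C > 0\<close> Suc.IH lip sub
        continuous_on_subset[OF continuous_on_picard[OF b] sub]
      by (intro drift_integral_contraction) (auto simp del: picard.simps)
    then show ?case by (simp add: mult.commute)
  qed
  \<comment> \<open>The iterates are the partial sums of a telescoping series dominated by a geometric one.\<close>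
  have "uniform_limit {0..T} (\<lambda>n t. \<Sum>k<n. picard b (Suc k) t - picard b k t)
          (\<lambda>t. \<Sum>k. picard b (Suc k) t - picard b k t) sequentially"
  proof (rule Weierstrass_m_test)
    fix k t assume t: "t \<in> {0..T}"
    have "C / 2 ^ k * exp (2 * L * t) \<le> C / 2 ^ k * exp (2 * L * T)"
      using t L \<open>C > 0\<close> by (intro mult_left_mono) auto
    with step[OF t, of k]
    show "norm (picard b (Suc k) t - picard b k t) \<le> C * exp (2 * L * T) * (1 / 2) ^ k"
      by (simp add: power_divide mult.commute)
  qed (intro summable_mult summable_geometric, simp)
  moreover have telescope: "b t + (\<Sum>k<n. picard b (Suc k) t - picard b k t) = picard b n t" for n t
    using sum_lessThan_telescope[of "\<lambda>k. picard b k t" n] by (simp del: picard.simps(2))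
  ultimately have "uniform_limit {0..T} (\<lambda>n t. b t + (\<Sum>k<n. picard b (Suc k) t - picard b k t))
          (\<lambda>t. b t + (\<Sum>k. picard b (Suc k) t - picard b k t)) sequentially"
    by (intro uniform_limit_intros) auto
  then have lim: "uniform_limit {0..T} (picard b)
          (\<lambda>t. b t + (\<Sum>k. picard b (Suc k) t - picard b k t)) sequentially"
    by (simp only: telescope)
  moreover have "flow b t = b t + (\<Sum>k. picard b (Suc k) t - picard b k t)" if "t \<in> {0..T}" for t
    unfolding flow_def using tendsto_uniform_limitI[OF lim that] by (rule limI)
  ultimately show ?thesis
    by (subst uniform_limit_cong') auto
qed

lemma continuous_on_flow:
  assumes "continuous_on {0..T} b"
  shows "continuous_on {0..T} (flow b)"
  using uniform_limit_picard[OF assms] continuous_on_picard[OF assms]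
  by (intro uniform_limit_theorem) auto

lemma flow_equation:
  assumes b: "continuous_on {0..} b" and "0 \<le> t"
  shows "flow b t = b t + integral {0..t} (\<lambda>s. h s (flow b s))"
proof -
  have b': "continuous_on {0..t} b" using b by (rule continuous_on_subset) auto
  obtain L where L: "L > 0"
    and lip: "\<And>s x y. s \<in> {0..t} \<Longrightarrow> \<bar>h s x - h s y\<bar> \<le> L * \<bar>x - y\<bar>"
    using lipschitz by meson
  have ul: "uniform_limit {0..t} (\<lambda>k s. h s (picard b k s)) (\<lambda>s. h s (flow b s)) sequentially"
  proof (rule uniform_limitI)
    fix e :: real assume "e > 0"
    then have "e / L > 0" using L by simp
    from uniform_limitD[OF uniform_limit_picard[OF b'] this]
    show "\<forall>\<^sub>F k in sequentially. \<forall>s\<in>{0..t}. dist (h s (picard b k s)) (h s (flow b s)) < e"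
    proof eventually_elim
      case (elim k)
      show ?case
      proof
        fix s assume s: "s \<in> {0..t}"
        have "L * \<bar>picard b k s - flow b s\<bar> < e"
          using elim s L by (auto simp: dist_real_def field_simps)
        with lip[OF s, of "picard b k s" "flow b s"]
        show "dist (h s (picard b k s)) (h s (flow b s)) < e" by (simp add: dist_real_def)
      qed
    qed
  qed
  have "(\<lambda>k. integral {0..t} (\<lambda>s. h s (picard b k s))) \<longlonglongrightarrow> integral {0..t} (\<lambda>s. h s (flow b s))"
  proof -
    obtain I J where I: "\<And>k. ((\<lambda>s. h s (picard b k s)) has_integral I k) {0..t}"
      and J: "((\<lambda>s. h s (flow b s)) has_integral J) {0..t}" and "I \<longlonglongrightarrow> J"
      using uniform_limit_integral[OF ul] continuous_on_drift[OF continuous_on_picard[OF b']]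
      by (metis trivial_limit_sequentially)
    then show ?thesis by (simp add: integral_unique[OF I] integral_unique[OF J])
  qed
  then have "(\<lambda>k. picard b (Suc k) t) \<longlonglongrightarrow> b t + integral {0..t} (\<lambda>s. h s (flow b s))"
    by (auto intro!: tendsto_intros)
  moreover have "(\<lambda>k. picard b (Suc k) t) \<longlonglongrightarrow> flow b t"
    using tendsto_uniform_limitI[OF uniform_limit_picard[OF b'], of t] \<open>0 \<le> t\<close>
    by (intro LIMSEQ_Suc) auto
  ultimately show ?thesis by (rule LIMSEQ_unique[symmetric])
qed

text \<open>Iterating the contraction estimate on the difference of two solutions bounds it by
\<open>C / 2 ^ k\<close> times the exponential weight for every \<open>k\<close>.\<close>

lemma flow_unique:
  assumes b: "continuous_on {0..} b" and x: "continuous_on {0..T} x"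
    and eq: "\<And>t. t \<in> {0..T} \<Longrightarrow> x t = b t + integral {0..t} (\<lambda>s. h s (x s))"
    and t: "t \<in> {0..T}"
  shows "x t = flow b t"
proof -
  have fl: "continuous_on {0..T} (flow b)"
    using b by (intro continuous_on_flow) (auto intro: continuous_on_subset)
  obtain L where L: "L > 0"
    and lip: "\<And>s x y. s \<in> {0..T} \<Longrightarrow> \<bar>h s x - h s y\<bar> \<le> L * \<bar>x - y\<bar>"
    using lipschitz by meson
  have cont: "continuous_on {0..T} (\<lambda>t. x t - flow b t)"
    using x fl by (intro continuous_intros)
  have "bounded ((\<lambda>t. x t - flow b t) ` {0..T})"
    using compact_continuous_image[OF cont] by (intro compact_imp_bounded) simp
  then obtain C where "C > 0" and C: "\<And>t. t \<in> {0..T} \<Longrightarrow> \<bar>x t - flow b t\<bar> \<le> C"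
    unfolding bounded_pos by auto
  have step: "\<bar>x t - flow b t\<bar> \<le> C / 2 ^ k * exp (2 * L * t)" if "t \<in> {0..T}" for k t
    using that
  proof (induction k arbitrary: t)
    case 0
    have "C * 1 \<le> C * exp (2 * L * t)"
      using 0 L \<open>C > 0\<close> by (intro mult_left_mono) auto
    with C[OF 0] show ?case by simp
  next
    case (Suc k)
    have sub: "{0..t} \<subseteq> {0..T}" using Suc.prems by auto
    have "\<bar>integral {0..t} (\<lambda>s. h s (x s)) - integral {0..t} (\<lambda>s. h s (flow b s))\<bar>
            \<le> C / 2 ^ k / 2 * exp (2 * L * t)"
      using Suc.prems L \<open>C > 0\<close> Suc.IH lip sub
        continuous_on_subset[OF x sub] continuous_on_subset[OF fl sub]
      by (intro drift_integral_contraction) auto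
    then show ?case using eq[OF Suc.prems] flow_equation[OF b, of t] Suc.prems
      by (simp add: mult.commute)
  qed
  have "(\<lambda>k. C * exp (2 * L * t) * (1 / 2) ^ k) \<longlonglongrightarrow> C * exp (2 * L * t) * 0"
    by (intro tendsto_intros LIMSEQ_power_zero) auto
  moreover have "\<bar>x t - flow b t\<bar> \<le> C * exp (2 * L * t) * (1 / 2) ^ k" for k
    using step[OF t, of k] by (simp add: power_divide mult.commute)
  ultimately have "\<bar>x t - flow b t\<bar> \<le> 0"
    by (intro LIMSEQ_le_const[of _ _ "\<bar>x t - flow b t\<bar>"]) auto
  then show ?thesis by simp
qed

end

section \<open>Measurable dependence on the driving path\<close>

text \<open>Approximation by the grid points \<open>i / n\<close>. It reduces statements about all real times to statements
about countably many of them; the value at negative \<open>s\<close> is that of \<open>0\<close>, so that the grid never leaves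
the half-line on which the paths are continuous.\<close>

lemma tendsto_nat_floor_grid:
  "(\<lambda>n. real (nat \<lfloor>real n * s\<rfloor>) / real n) \<longlonglongrightarrow> max 0 s"
proof (rule tendsto_sandwich)
  show "\<forall>\<^sub>F n in sequentially. max 0 s - inverse (real n) \<le> real (nat \<lfloor>real n * s\<rfloor>) / real n"
    using eventually_gt_at_top[of 0]
  proof eventually_elim
    case (elim n)
    have "max 0 (real n * s) - 1 \<le> real (nat \<lfloor>real n * s\<rfloor>)" by linarith
    moreover have "max 0 (real n * s) = real n * max 0 s"
      by (simp add: max_mult_distrib_left)
    ultimately have "real n * max 0 s - 1 \<le> real (nat \<lfloor>real n * s\<rfloor>)" by simp
    with elim have "(real n * max 0 s - 1) / real n \<le> real (nat \<lfloor>real n * s\<rfloor>) / real n"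
      by (intro divide_right_mono) auto
    then show ?case using elim by (simp add: diff_divide_distrib inverse_eq_divide)
  qed
  show "\<forall>\<^sub>F n in sequentially. real (nat \<lfloor>real n * s\<rfloor>) / real n \<le> max 0 s"
    using eventually_gt_at_top[of 0]
  proof eventually_elim
    case (elim n)
    have "real (nat \<lfloor>real n * s\<rfloor>) \<le> max 0 (real n * s)" by linarith
    moreover have "max 0 (real n * s) = real n * max 0 s"
      by (simp add: max_mult_distrib_left)
    ultimately show ?case using elim by (simp add: field_simps)
  qed
  show "(\<lambda>n. max 0 s - inverse (real n)) \<longlonglongrightarrow> max 0 s"
    using tendsto_diff[OF tendsto_const lim_inverse_n] by simp
qed auto

text \<open>A process with continuous paths is jointly measurable in time and outcome, being the pointwise limit of
its versions frozen at the preceding grid point; Fubini then makes its time integral measurable.\<close>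

lemma borel_measurable_integral_continuous_process:
  fixes X :: "real \<Rightarrow> 'a \<Rightarrow> real"
  assumes meas: "\<And>s. 0 \<le> s \<Longrightarrow> X s \<in> borel_measurable M"
    and cont: "\<And>\<omega>. \<omega> \<in> space M \<Longrightarrow> continuous_on {0..} (\<lambda>s. X s \<omega>)"
  shows "(\<lambda>\<omega>. integral {0..t} (\<lambda>s. X s \<omega>)) \<in> borel_measurable M"
proof -
  have "(\<lambda>p. X (max 0 (snd p)) (fst p)) \<in> borel_measurable (M \<Otimes>\<^sub>M lborel)"
  proof (rule borel_measurable_LIMSEQ_real)
    fix p :: "'a \<times> real" assume "p \<in> space (M \<Otimes>\<^sub>M lborel)"
    then have "fst p \<in> space M" by (auto simp: space_pair_measure)
    from cont[OF this]
    show "(\<lambda>n. X (real (nat \<lfloor>real n * snd p\<rfloor>) / real n) (fst p)) \<longlonglongrightarrow> X (max 0 (snd p)) (fst p)"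
      by (rule continuous_on_tendsto_compose[OF _ tendsto_nat_floor_grid]) auto
  next
    fix n
    show "(\<lambda>p :: 'a \<times> real. X (real (nat \<lfloor>real n * snd p\<rfloor>) / real n) (fst p))
            \<in> borel_measurable (M \<Otimes>\<^sub>M lborel)"
    proof (rule measurable_compose_countable[where f = "\<lambda>i p. X (real i / real n) (fst p)"])
      fix i :: nat
      show "(\<lambda>p :: 'a \<times> real. X (real i / real n) (fst p)) \<in> borel_measurable (M \<Otimes>\<^sub>M lborel)"
        by (rule measurable_compose[OF measurable_fst meas]) simp
    qed measurable
  qed
  then have [measurable]: "(\<lambda>(\<omega>, s). X (max 0 s) \<omega>) \<in> borel_measurable (M \<Otimes>\<^sub>M lborel)"
    by (simp add: case_prod_beta')
  have "(\<lambda>\<omega>. LINT s:{0..t}|lborel. X (max 0 s) \<omega>) \<in> borel_measurable M"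
    unfolding set_lebesgue_integral_def by measurable
  also have "?this \<longleftrightarrow> ?thesis"
  proof (rule measurable_cong)
    fix \<omega> assume "\<omega> \<in> space M"
    from cont[OF this] have c: "continuous_on {0..t} (\<lambda>s. X s \<omega>)"
      by (rule continuous_on_subset) auto
    have "(LINT s:{0..t}|lborel. X (max 0 s) \<omega>) = (LINT s:{0..t}|lborel. X s \<omega>)"
      by (rule set_lebesgue_integral_cong) auto
    also have "\<dots> = integral {0..t} (\<lambda>s. X s \<omega>)"
      by (rule set_borel_integral_eq_integral) (rule borel_integrable_atLeastAtMost'[OF c])
    finally show "(LINT s:{0..t}|lborel. X (max 0 s) \<omega>) = integral {0..t} (\<lambda>s. X s \<omega>)" .
  qed
  finally show ?thesis .
qed

lemma continuous_on_half_line: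
  fixes x :: "real \<Rightarrow> real"
  assumes "\<And>T. continuous_on {0..T} x"
  shows "continuous_on {0..} x"
  unfolding continuous_on_eq_continuous_within
proof
  fix t :: real assume "t \<in> {0..}"
  then have "continuous (at t within {0..t + 1}) x"
    using assms[of "t + 1"] by (auto simp: continuous_on_eq_continuous_within)
  moreover have "at t within {0..t + 1} = at t within {0..}"
    by (rule at_within_nhd[of _ "{..<t + 1}"]) auto
  ultimately show "continuous (at t within {0..}) x"
    by simp
qed

context lipschitz_drift
begin

lemma borel_measurable_drift:
  assumes "0 \<le> s"
  shows "h s \<in> borel_measurable borel"
proof -
  have "continuous_on UNIV (\<lambda>x. (\<lambda>(t, x). h t x) (s, x))"
    using assms by (intro continuous_on_compose2[OF continuous]) (auto intro!: continuous_intros)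
  then show ?thesis by (simp add: borel_measurable_continuous_onI)
qed

lemma borel_measurable_picard:
  fixes b :: "real \<Rightarrow> 'a \<Rightarrow> real"
  assumes meas: "\<And>s. 0 \<le> s \<Longrightarrow> b s \<in> borel_measurable M"
    and cont: "\<And>\<omega>. \<omega> \<in> space M \<Longrightarrow> continuous_on {0..} (\<lambda>s. b s \<omega>)"
    and "0 \<le> t"
  shows "(\<lambda>\<omega>. picard (\<lambda>s. b s \<omega>) k t) \<in> borel_measurable M"
  using \<open>0 \<le> t\<close>
proof (induction k arbitrary: t)
  case 0
  then show ?case using meas by simp
next
  case (Suc k)
  have "(\<lambda>\<omega>. integral {0..t} (\<lambda>s. h s (picard (\<lambda>s. b s \<omega>) k s))) \<in> borel_measurable M"
  proof (rule borel_measurable_integral_continuous_process)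
    fix s :: real assume "0 \<le> s"
    then show "(\<lambda>\<omega>. h s (picard (\<lambda>s. b s \<omega>) k s)) \<in> borel_measurable M"
      by (intro measurable_compose[OF Suc.IH borel_measurable_drift])
  next
    fix \<omega> assume \<omega>: "\<omega> \<in> space M"
    have "continuous_on {0..T} (\<lambda>s. h s (picard (\<lambda>s. b s \<omega>) k s))" for T
      by (intro continuous_on_drift continuous_on_picard continuous_on_subset[OF cont[OF \<omega>]]) auto
    then show "continuous_on {0..} (\<lambda>s. h s (picard (\<lambda>s. b s \<omega>) k s))"
      by (rule continuous_on_half_line)
  qed
  with meas[OF Suc.prems] show ?case by simp
qed

lemma borel_measurable_flow:
  fixes b :: "real \<Rightarrow> 'a \<Rightarrow> real"
  assumes "\<And>s. 0 \<le> s \<Longrightarrow> b s \<in> borel_measurable M"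
    and "\<And>\<omega>. \<omega> \<in> space M \<Longrightarrow> continuous_on {0..} (\<lambda>s. b s \<omega>)"
    and "0 \<le> t"
  shows "(\<lambda>\<omega>. flow (\<lambda>s. b s \<omega>) t) \<in> borel_measurable M"
  unfolding flow_def
  by (intro borel_measurable_lim_metric borel_measurable_picard assms)

end

section \<open>Gluing the solutions of truncated equations\<close>

text \<open>An exhaustion of the open half-line by compact intervals, on each of which a locally Lipschitz drift
is Lipschitz.\<close>

definition window :: "nat \<Rightarrow> real set" where
  "window n = {1 / real (Suc n)..real (Suc n)}"

lemma window_mono: "m \<le> n \<Longrightarrow> window m \<subseteq> window n"
  by (auto simp: window_def frac_le intro: order_trans[rotated])

lemma window_Suc:
  assumes "x \<in> window n"
  shows "1 / real (Suc (Suc n)) < x" "x < real (Suc (Suc n))"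
proof -
  have "1 / real (Suc (Suc n)) < 1 / real (Suc n)" by (intro divide_strict_left_mono) auto
  with assms show "1 / real (Suc (Suc n)) < x" "x < real (Suc (Suc n))"
    unfolding window_def by auto
qed

lemma window_pos: "x \<in> window n \<Longrightarrow> 0 < x"
  by (auto simp: window_def intro: less_le_trans[rotated])

lemma closed_window: "closed (window n)"
  by (simp add: window_def)

lemma Icc_subset_window:
  assumes "0 < a"
  shows "\<exists>n. {a..c} \<subseteq> window n"
proof -
  obtain n where n: "max (1 / a) c \<le> real n" using real_arch_simple by blast
  then have "1 / a \<le> real (Suc n)" "c \<le> real (Suc n)" by auto
  then have "1 / real (Suc n) \<le> a" "c \<le> real (Suc n)"
    using assms by (auto simp: field_simps)
  then show ?thesis unfolding window_def by (intro exI[of _ n]) auto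
qed

text \<open>The drift is singular at \<open>0\<close>: it is controlled only on compact parts of the open half-line. Negativity
above some level prevents solutions from escaping to infinity.\<close>

locale singular_drift =
  fixes g :: "real \<Rightarrow> real \<Rightarrow> real"
  assumes continuous: "continuous_on ({0..} \<times> {0<..}) (\<lambda>(t, x). g t x)"
    and locally_lipschitz: "\<And>T a c. 0 < a \<Longrightarrow>
      \<exists>L>0. \<forall>t\<in>{0..T}. \<forall>x\<in>{a..c}. \<forall>y\<in>{a..c}. \<bar>g t x - g t y\<bar> \<le> L * \<bar>x - y\<bar>"
    and negative_above: "\<exists>x0>0. \<forall>x>x0. \<forall>t\<ge>0. g t x < 0"
begin

text \<open>Freezing the drift outside a window makes it globally Lipschitz and leaves it unchanged as long as the
solution stays in the window.\<close>

definition truncated :: "nat \<Rightarrow> real \<Rightarrow> real \<Rightarrow> real" where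
  "truncated n t x = g t (clamp (1 / real (Suc n)) (real (Suc n)) x)"

lemma window_endpoints: "1 / real (Suc n) \<le> real (Suc n)"
  by (simp add: field_simps)

lemma clamp_window: "clamp (1 / real (Suc n)) (real (Suc n)) x \<in> window n"
proof -
  have "clamp (1 / real (Suc n)) (real (Suc n)) x \<in> cbox (1 / real (Suc n)) (real (Suc n))"
    by (rule clamp_in_interval) (simp add: window_endpoints del: of_nat_Suc)
  then show ?thesis by (simp add: window_def)
qed

lemma truncated_eq: "x \<in> window n \<Longrightarrow> truncated n t x = g t x"
  unfolding truncated_def window_def by (subst clamp_cancel_cbox) auto

sublocale trunc: lipschitz_drift "truncated n" for n
proof
  let ?c = "clamp (1 / real (Suc n)) (real (Suc n))"
  have "continuous_on UNIV (\<lambda>x. ?c x)"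
    by (rule clamp_continuous_on) (rule continuous_on_id)
  then have "continuous_on ({0..} \<times> UNIV) (\<lambda>p::real \<times> real. ?c (snd p))"
    by (rule continuous_on_compose2) (auto intro: continuous_on_snd continuous_on_id)
  then have "continuous_on ({0..} \<times> UNIV) (\<lambda>p::real \<times> real. (fst p, ?c (snd p)))"
    by (intro continuous_on_Pair continuous_on_fst continuous_on_id)
  then have "continuous_on ({0..} \<times> UNIV) (\<lambda>p. (\<lambda>(t, x). g t x) (fst p, ?c (snd p)))"
    by (rule continuous_on_compose2[OF continuous]) (auto simp del: of_nat_Suc intro: window_pos clamp_window)
  then show "continuous_on ({0..} \<times> UNIV) (\<lambda>(t, x). truncated n t x)"
    by (simp add: truncated_def case_prod_beta')
next
  fix T :: real
  obtain L where L: "L > 0" and lip: "\<And>t x y. t \<in> {0..T} \<Longrightarrow> x \<in> window n \<Longrightarrow> y \<in> window n \<Longrightarrow>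
      \<bar>g t x - g t y\<bar> \<le> L * \<bar>x - y\<bar>"
    using locally_lipschitz[of "1 / real (Suc n)" T "real (Suc n)"] unfolding window_def by auto
  show "\<exists>L>0. \<forall>t\<in>{0..T}. \<forall>x y. \<bar>truncated n t x - truncated n t y\<bar> \<le> L * \<bar>x - y\<bar>"
  proof (intro exI[of _ L] conjI ballI allI L)
    fix t x y assume t: "t \<in> {0..T}"
    let ?c = "clamp (1 / real (Suc n)) (real (Suc n))"
    have "\<bar>truncated n t x - truncated n t y\<bar> \<le> L * \<bar>?c x - ?c y\<bar>"
      unfolding truncated_def by (intro lip t clamp_window)
    also have "\<dots> \<le> L * \<bar>x - y\<bar>"
      using L dist_clamps_le_dist_args[of "1 / real (Suc n)" "real (Suc n)" x y]
      by (intro mult_left_mono) (auto simp: dist_real_def)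
    finally show "\<bar>truncated n t x - truncated n t y\<bar> \<le> L * \<bar>x - y\<bar>" .
  qed
qed

definition solves :: "(real \<Rightarrow> real) \<Rightarrow> real \<Rightarrow> (real \<Rightarrow> real) \<Rightarrow> bool" where
  "solves b T z \<longleftrightarrow> continuous_on {0..T} z \<and>
     (\<forall>t\<in>{0..T}. 0 < z t \<and> z t = b t + integral {0..t} (\<lambda>s. g s (z s)))"

lemma solvesD:
  assumes "solves b T z"
  shows "continuous_on {0..T} z"
    and "t \<in> {0..T} \<Longrightarrow> 0 < z t"
    and "t \<in> {0..T} \<Longrightarrow> z t = b t + integral {0..t} (\<lambda>s. g s (z s))"
  using assms unfolding solves_def by blast+

lemma solves_cong:
  assumes z: "solves b T z" and eq: "\<And>t. t \<in> {0..T} \<Longrightarrow> y t = z t"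
  shows "solves b T y"
  unfolding solves_def
proof (intro conjI ballI)
  show "continuous_on {0..T} y"
    using solvesD(1)[OF z] by (subst continuous_on_cong[OF refl eq])
  fix t assume t: "t \<in> {0..T}"
  show "0 < y t" using solvesD(2)[OF z t] eq[OF t] by simp
  have "integral {0..t} (\<lambda>s. g s (y s)) = integral {0..t} (\<lambda>s. g s (z s))"
    using t eq by (intro integral_cong) auto
  then show "y t = b t + integral {0..t} (\<lambda>s. g s (y s))"
    using solvesD(3)[OF z t] eq[OF t] by (simp only:)
qed

lemma solves_in_window:
  assumes "solves b T z"
  shows "\<exists>n. \<forall>t\<in>{0..T}. z t \<in> window n"
proof (cases "0 \<le> T")
  case True
  note c = solvesD(1)[OF assms] and pos = solvesD(2)[OF assms]
  obtain s where s: "s \<in> {0..T}" "\<And>t. t \<in> {0..T} \<Longrightarrow> z s \<le> z t"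
    using continuous_attains_inf[OF _ _ c] True by force
  obtain u where u: "u \<in> {0..T}" "\<And>t. t \<in> {0..T} \<Longrightarrow> z t \<le> z u"
    using continuous_attains_sup[OF _ _ c] True by force
  show ?thesis
    using Icc_subset_window[OF pos[OF s(1)], of "z u"] s u by (meson atLeastAtMost_iff subset_iff)
qed auto

lemma solves_eq_trunc_flow:
  assumes b: "continuous_on {0..} b" and z: "solves b T z"
    and win: "\<And>t. t \<in> {0..T} \<Longrightarrow> z t \<in> window n" and t: "t \<in> {0..T}"
  shows "z t = trunc.flow n b t"
proof (rule trunc.flow_unique[OF b _ _ t])
  show "continuous_on {0..T} z" by (rule solvesD(1)[OF z])
  fix t assume t: "t \<in> {0..T}"
  have "integral {0..t} (\<lambda>s. truncated n s (z s)) = integral {0..t} (\<lambda>s. g s (z s))"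
    using t win by (intro integral_cong truncated_eq) auto
  then show "z t = b t + integral {0..t} (\<lambda>s. truncated n s (z s))"
    using solvesD(3)[OF z t] by (simp only:)
qed

lemma trunc_flow_solves:
  assumes b: "continuous_on {0..} b" and win: "\<And>t. t \<in> {0..T} \<Longrightarrow> trunc.flow n b t \<in> window n"
  shows "solves b T (trunc.flow n b)"
  unfolding solves_def
proof (intro conjI ballI)
  show "continuous_on {0..T} (trunc.flow n b)"
    by (intro trunc.continuous_on_flow continuous_on_subset[OF b]) auto
  fix t assume t: "t \<in> {0..T}"
  show "0 < trunc.flow n b t" using win[OF t] by (rule window_pos)
  have "trunc.flow n b t = b t + integral {0..t} (\<lambda>s. truncated n s (trunc.flow n b s))"
    using t by (intro trunc.flow_equation b) auto
  also have "integral {0..t} (\<lambda>s. truncated n s (trunc.flow n b s))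
               = integral {0..t} (\<lambda>s. g s (trunc.flow n b s))"
    using t win by (intro integral_cong truncated_eq) auto
  finally show "trunc.flow n b t = b t + integral {0..t} (\<lambda>s. g s (trunc.flow n b s))" .
qed

definition stays :: "nat \<Rightarrow> (real \<Rightarrow> real) \<Rightarrow> real \<Rightarrow> bool" where
  "stays n b T \<longleftrightarrow> (\<forall>t\<in>{0..T}. trunc.flow n b t \<in> window n)"

text \<open>Up to a time at which the singular equation is still solvable, the terms are eventually constant, equal
to the solution; after that every term vanishes, so the path is absorbed at \<open>0\<close>. Being a limit of
countably many measurable expressions, this choice of the maximal solution is measurable.\<close>

definition glued :: "(real \<Rightarrow> real) \<Rightarrow> real \<Rightarrow> real" where
  "glued b t = lim (\<lambda>n. if stays n b t then trunc.flow n b t else 0)"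

lemma glued_eq:
  assumes b: "continuous_on {0..} b" and z: "solves b T z" and t: "t \<in> {0..T}"
  shows "glued b t = z t"
proof -
  obtain n where n: "\<And>t. t \<in> {0..T} \<Longrightarrow> z t \<in> window n"
    using solves_in_window[OF z] by blast
  have "(if stays m b t then trunc.flow m b t else 0) = z t" if "n \<le> m" for m
  proof -
    have win: "\<And>t. t \<in> {0..T} \<Longrightarrow> z t \<in> window m" using n window_mono[OF that] by blast
    have eq: "\<And>t. t \<in> {0..T} \<Longrightarrow> z t = trunc.flow m b t"
      using solves_eq_trunc_flow[OF b z win] .
    then have "stays m b t" using win t by (auto simp: stays_def)
    with eq t show ?thesis by simp
  qed
  then have "(\<lambda>m. if stays m b t then trunc.flow m b t else 0) \<longlonglongrightarrow> z t"
    by (intro tendsto_eventually eventually_sequentiallyI[of n])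
  then show ?thesis unfolding glued_def by (rule limI)
qed

lemma solves_glued:
  assumes b: "continuous_on {0..} b" and z: "solves b T z"
  shows "solves b T (glued b)"
  using z glued_eq[OF b z] by (rule solves_cong)

lemma glued_eq_0:
  assumes b: "continuous_on {0..} b" and "\<not> solves b t (glued b)"
  shows "glued b t = 0"
proof -
  have "\<not> stays n b t" for n
    using trunc_flow_solves[OF b] solves_glued[OF b] assms unfolding stays_def by blast
  then show ?thesis unfolding glued_def by (auto intro: limI)
qed

text \<open>Since the path is continuous and the window closed, countably many times decide whether the path stays
in the window; hence this is a measurable event. For \<open>k = 0\<close> only the time \<open>0\<close> is tested.\<close>

lemma stays_iff_rational:
  assumes b: "continuous_on {0..} b" and "0 \<le> T"
  shows "stays n b T \<longleftrightarrow> (\<forall>k. \<forall>i\<le>k. trunc.flow n b (real i / real k * T) \<in> window n)"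
    (is "_ \<longleftrightarrow> ?R")
proof
  assume "stays n b T"
  moreover have "real i / real k * T \<in> {0..T}" if "i \<le> k" for i k
  proof -
    have "real i / real k \<le> 1" using that by (auto simp: divide_le_eq_1)
    then have "real i / real k * T \<le> 1 * T" using \<open>0 \<le> T\<close> by (rule mult_right_mono)
    then show ?thesis using \<open>0 \<le> T\<close> by simp
  qed
  ultimately show ?R unfolding stays_def by blast
next
  assume R: ?R
  show "stays n b T" unfolding stays_def
  proof
    fix t assume t: "t \<in> {0..T}"
    define r where "r = t / T"
    have r: "0 \<le> r" "r \<le> 1" "r * T = t"
      using t by (auto simp: r_def divide_le_eq_1)
    have grid: "nat \<lfloor>real k * r\<rfloor> \<le> k" for k
    proof -
      have "real k * r \<le> real k * 1" using r by (intro mult_left_mono) auto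
      then show ?thesis by linarith
    qed
    have "(\<lambda>k. real (nat \<lfloor>real k * r\<rfloor>) / real k * T) \<longlonglongrightarrow> max 0 r * T"
      by (intro tendsto_mult tendsto_nat_floor_grid tendsto_const)
    then have lim: "(\<lambda>k. real (nat \<lfloor>real k * r\<rfloor>) / real k * T) \<longlonglongrightarrow> t"
      using r by simp
    have "continuous_on {0..} (trunc.flow n b)"
      by (intro continuous_on_half_line trunc.continuous_on_flow continuous_on_subset[OF b]) auto
    then have "(\<lambda>k. trunc.flow n b (real (nat \<lfloor>real k * r\<rfloor>) / real k * T)) \<longlonglongrightarrow> trunc.flow n b t"
      by (rule continuous_on_tendsto_compose[OF _ lim]) (use t \<open>0 \<le> T\<close> in auto)
    moreover have "trunc.flow n b (real (nat \<lfloor>real k * r\<rfloor>) / real k * T) \<in> window n" for k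
      using R grid[of k] by blast
    ultimately show "trunc.flow n b t \<in> window n"
      by (rule closed_sequentially[OF closed_window, rotated])
  qed
qed

lemma borel_measurable_glued:
  fixes b :: "real \<Rightarrow> 'a \<Rightarrow> real"
  assumes meas: "\<And>s. 0 \<le> s \<Longrightarrow> b s \<in> borel_measurable M"
    and cont: "\<And>\<omega>. \<omega> \<in> space M \<Longrightarrow> continuous_on {0..} (\<lambda>s. b s \<omega>)"
    and "0 \<le> t"
  shows "(\<lambda>\<omega>. glued (\<lambda>s. b s \<omega>) t) \<in> borel_measurable M"
proof -
  have flow: "(\<lambda>\<omega>. trunc.flow n (\<lambda>s. b s \<omega>) t) \<in> borel_measurable M" if "0 \<le> t" for n t
    using that by (intro trunc.borel_measurable_flow meas cont)
  have "Measurable.pred M (\<lambda>\<omega>. \<forall>k. \<forall>i\<in>{..k}.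
          trunc.flow n (\<lambda>s. b s \<omega>) (real i / real k * t) \<in> window n)" for n
  proof (intro pred_intros_countable pred_intros_finite finite_atMost)
    fix k i :: nat
    show "Measurable.pred M (\<lambda>\<omega>. trunc.flow n (\<lambda>s. b s \<omega>) (real i / real k * t) \<in> window n)"
      by (rule pred_sets2[OF _ flow]) (use \<open>0 \<le> t\<close> in \<open>auto simp: window_def\<close>)
  qed
  moreover have "Measurable.pred M (\<lambda>\<omega>. stays n (\<lambda>s. b s \<omega>) t) \<longleftrightarrow>
      Measurable.pred M (\<lambda>\<omega>. \<forall>k. \<forall>i\<in>{..k}.
          trunc.flow n (\<lambda>s. b s \<omega>) (real i / real k * t) \<in> window n)" for n
    by (rule measurable_cong) (simp only: stays_iff_rational[OF cont \<open>0 \<le> t\<close>] Ball_def atMost_iff)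
  ultimately have "Measurable.pred M (\<lambda>\<omega>. stays n (\<lambda>s. b s \<omega>) t)" for n by simp
  then have "{\<omega> \<in> space M. stays n (\<lambda>s. b s \<omega>) t} \<in> sets M" for n by (simp add: pred_def)
  then have "(\<lambda>\<omega>. if stays n (\<lambda>s. b s \<omega>) t then trunc.flow n (\<lambda>s. b s \<omega>) t else 0)
      \<in> borel_measurable M" for n
    by (rule measurable_If[OF flow[OF \<open>0 \<le> t\<close>] borel_measurable_const])
  then show ?thesis
    unfolding glued_def by (rule borel_measurable_lim_metric)
qed

end

section \<open>Behaviour at the end of the life time\<close>

text \<open>The bound is assumed only in the interior because it is used on excursions, at one end of which the
defining inequality fails.\<close>

lemma integral_le_interior_bound:
  fixes \<phi> :: "real \<Rightarrow> real"
  assumes "a \<le> b" "continuous_on {a..b} \<phi>" and le: "\<And>s. a < s \<Longrightarrow> s < b \<Longrightarrow> \<phi> s \<le> c"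
  shows "integral {a..b} \<phi> \<le> c * (b - a)"
proof -
  have i: "\<phi> integrable_on {a<..<b}"
    using integrable_continuous_real[OF assms(2)] by (simp add: integrable_on_open_interval_real)
  have c: "(\<lambda>_. c) integrable_on {a<..<b}"
    using integrable_const_ivl[of c a b] by (simp only: integrable_on_open_interval_real)
  have "integral {a..b} \<phi> \<le> integral {a..b} (\<lambda>_. c)"
    unfolding integral_open_interval_real[of a b] by (rule integral_le[OF i c]) (simp add: le)
  also have "\<dots> = c * (b - a)" using \<open>a \<le> b\<close> by simp
  finally show ?thesis .
qed

lemma last_time_below:
  fixes z :: "real \<Rightarrow> real"
  assumes z: "continuous_on {a..t} z" and u: "u \<in> {a..t}" "z u \<le> c"
  obtains s where "s \<in> {a..t}" "z s \<le> c" "\<And>r. s < r \<Longrightarrow> r \<le> t \<Longrightarrow> c < z r"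
proof -
  let ?S = "{a..t} \<inter> {s \<in> {a..t}. z s \<le> c}"
  have "compact ?S"
    by (intro compact_Int_closed compact_Icc continuous_on_closed_Collect_le z continuous_on_const
          closed_atLeastAtMost)
  moreover have "?S \<noteq> {}" using u by blast
  ultimately have "\<exists>s\<in>?S. \<forall>r\<in>?S. r \<le> s" by (rule compact_attains_sup)
  then obtain s where s: "s \<in> ?S" and last: "\<And>r. r \<in> ?S \<Longrightarrow> r \<le> s" by blast
  show ?thesis
  proof (rule that)
    show "s \<in> {a..t}" "z s \<le> c" using s by auto
    show "c < z r" if "s < r" "r \<le> t" for r
      using last[of r] s that by (cases "z r \<le> c") auto
  qed
qed

lemma first_time_below:
  fixes z :: "real \<Rightarrow> real"
  assumes z: "continuous_on {a..t} z" and u: "u \<in> {a..t}" "z u \<le> c"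
  obtains s where "s \<in> {a..t}" "z s \<le> c" "\<And>r. a \<le> r \<Longrightarrow> r < s \<Longrightarrow> c < z r"
proof -
  let ?S = "{a..t} \<inter> {s \<in> {a..t}. z s \<le> c}"
  have "compact ?S"
    by (intro compact_Int_closed compact_Icc continuous_on_closed_Collect_le z continuous_on_const
          closed_atLeastAtMost)
  moreover have "?S \<noteq> {}" using u by blast
  ultimately have "\<exists>s\<in>?S. \<forall>r\<in>?S. s \<le> r" by (rule compact_attains_inf)
  then obtain s where s: "s \<in> ?S" and first: "\<And>r. r \<in> ?S \<Longrightarrow> s \<le> r" by blast
  show ?thesis
  proof (rule that)
    show "s \<in> {a..t}" "z s \<le> c" using s by auto
    show "c < z r" if "a \<le> r" "r < s" for r
      using first[of r] s that by (cases "z r \<le> c") auto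
  qed
qed

context singular_drift
begin

lemma continuous_on_drift:
  assumes "solves b T z"
  shows "continuous_on {0..T} (\<lambda>s. g s (z s))"
proof -
  have "continuous_on {0..T} (\<lambda>s. (\<lambda>(t, x). g t x) (s, z s))"
    using solvesD[OF assms]
    by (intro continuous_on_compose2[OF continuous]) (auto intro!: continuous_on_Pair continuous_on_id)
  then show ?thesis by simp
qed

lemma solves_increment:
  assumes z: "solves b T z" and "0 \<le> s" "s \<le> t" "t \<le> T"
  shows "z t - z s = b t - b s + integral {s..t} (\<lambda>r. g r (z r))"
proof -
  have "(\<lambda>r. g r (z r)) integrable_on {0..t}"
    by (rule integrable_continuous_real)
      (rule continuous_on_subset[OF continuous_on_drift[OF z]], use assms in auto)
  then have "integral {0..s} (\<lambda>r. g r (z r)) + integral {s..t} (\<lambda>r. g r (z r))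
               = integral {0..t} (\<lambda>r. g r (z r))"
    using assms by (intro Henstock_Kurzweil_Integration.integral_combine) auto
  moreover have "s \<in> {0..T}" "t \<in> {0..T}" using assms by auto
  ultimately show ?thesis using solvesD(3)[OF z] by (smt (verit))
qed

text \<open>After the last time \<open>s\<close> at which the solution is below \<open>x0\<close> the drift is negative, so the solution can
rise above \<open>x0\<close> only by the oscillation \<open>2 * B\<close> of the driving path. If the solution was never below
\<open>x0\<close>, it is below the driving path.\<close>

lemma solves_upper_bound:
  assumes z: "solves b T z" and x0: "0 < x0" "\<And>t x. x0 < x \<Longrightarrow> 0 \<le> t \<Longrightarrow> g t x < 0"
    and B: "\<And>t. t \<in> {0..T} \<Longrightarrow> \<bar>b t\<bar> \<le> B" and t: "t \<in> {0..T}"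
  shows "z t \<le> x0 + 2 * B"
proof (cases "\<exists>s\<in>{0..t}. z s \<le> x0")
  case True
  have c: "continuous_on {0..t} z"
    by (rule continuous_on_subset[OF solvesD(1)[OF z]]) (use t in auto)
  obtain s where s: "s \<in> {0..t}" "z s \<le> x0" and last: "\<And>r. s < r \<Longrightarrow> r \<le> t \<Longrightarrow> x0 < z r"
    using True last_time_below[OF c] by metis
  have "integral {s..t} (\<lambda>r. g r (z r)) \<le> 0 * (t - s)"
  proof (rule integral_le_interior_bound)
    show "continuous_on {s..t} (\<lambda>r. g r (z r))"
      by (rule continuous_on_subset[OF continuous_on_drift[OF z]]) (use s t in auto)
    fix r assume r: "s < r" "r < t"
    then have "x0 < z r" using last[of r] by simp
    then show "g r (z r) \<le> 0" using x0(2)[of "z r" r] r s by auto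
  qed (use s in auto)
  moreover have "z t - z s = b t - b s + integral {s..t} (\<lambda>r. g r (z r))"
    using s t by (intro solves_increment[OF z]) auto
  moreover have "\<bar>b t\<bar> \<le> B" "\<bar>b s\<bar> \<le> B" using s t by (auto intro: B)
  ultimately show ?thesis using s by linarith
next
  case False
  have "integral {0..t} (\<lambda>r. g r (z r)) \<le> 0 * (t - 0)"
  proof (rule integral_le_interior_bound)
    show "continuous_on {0..t} (\<lambda>r. g r (z r))"
      by (rule continuous_on_subset[OF continuous_on_drift[OF z]]) (use t in auto)
    fix r assume r: "0 < r" "r < t"
    then have "x0 < z r" using False t by (meson atLeastAtMost_iff less_imp_le not_le)
    then show "g r (z r) \<le> 0" using x0(2)[of "z r" r] r by auto
  qed (use t in auto)
  moreover have "\<bar>b t\<bar> \<le> B" using t by (rule B)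
  ultimately show ?thesis using solvesD(3)[OF z t] x0 by linarith
qed

text \<open>A solution that stays in one window on a compact interval lies in the interior of the next window, where
the flow of the truncated drift continues it.\<close>

lemma solves_extend:
  assumes b: "continuous_on {0..} b" and z: "solves b t z" and "0 \<le> t"
  shows "\<exists>T>t. solves b T (glued b)"
proof -
  obtain n where win: "\<And>s. s \<in> {0..t} \<Longrightarrow> z s \<in> window n"
    using solves_in_window[OF z] by blast
  have win': "\<And>s. s \<in> {0..t} \<Longrightarrow> z s \<in> window (Suc n)"
    using win window_mono[of n "Suc n"] by auto
  let ?y = "trunc.flow (Suc n) b"
  have eq: "z s = ?y s" if "s \<in> {0..t}" for s
    using solves_eq_trunc_flow[OF b z win' that] .
  have yt: "?y t \<in> {1 / real (Suc (Suc n))<..<real (Suc (Suc n))}"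
    using window_Suc[OF win[of t]] eq[of t] \<open>0 \<le> t\<close> by simp
  have "continuous_on {0..t + 1} ?y"
    by (intro trunc.continuous_on_flow continuous_on_subset[OF b]) auto
  then have "(?y \<longlongrightarrow> ?y t) (at t within {0..t + 1})"
    using \<open>0 \<le> t\<close> by (auto simp: continuous_on_def)
  then have "\<forall>\<^sub>F s in at t within {0..t + 1}. ?y s \<in> {1 / real (Suc (Suc n))<..<real (Suc (Suc n))}"
    using yt by (intro topological_tendstoD) auto
  then obtain d where "d > 0" and d: "\<And>s. s \<in> {0..t + 1} \<Longrightarrow> s \<noteq> t \<Longrightarrow> dist s t < d \<Longrightarrow>
      ?y s \<in> {1 / real (Suc (Suc n))<..<real (Suc (Suc n))}"
    unfolding eventually_at by auto
  define T where "T = t + min 1 (d / 2)"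
  have "T > t" using \<open>d > 0\<close> by (simp add: T_def)
  have "solves b T ?y"
  proof (rule trunc_flow_solves[OF b])
    fix s assume s: "s \<in> {0..T}"
    show "?y s \<in> window (Suc n)"
    proof (cases "s \<le> t")
      case True
      then show ?thesis using s eq[of s] win'[of s] by simp
    next
      case False
      then have "dist s t < d" "s \<in> {0..t + 1}"
        using s \<open>d > 0\<close> by (auto simp: T_def dist_real_def)
      from d[OF this(2) _ this(1)] False show ?thesis by (auto simp: window_def)
    qed
  qed
  then show ?thesis using solves_glued[OF b] \<open>T > t\<close> by blast
qed

text \<open>A solution that cannot be continued to \<open>\<tau>\<close> leaves every window as \<open>t\<close> approaches \<open>\<tau>\<close>, and being bounded
above it must come arbitrarily close to \<open>0\<close>. It cannot return to a level \<open>e\<close> infinitely often: on the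
strip between \<open>e/2\<close> and the upper bound the drift is bounded and the driving path is uniformly continuous,
so a descent from \<open>e\<close> to \<open>e/2\<close> takes at least a time \<open>\<delta>\<close>. If the solution were above \<open>e\<close> at a time
\<open>r\<close> with \<open>\<tau> - \<delta> < r\<close>, it would thus stay above \<open>e/2\<close> until \<open>\<tau>\<close>, hence in one window, and could be continued.\<close>

lemma glued_tendsto_0:
  assumes b: "continuous_on {0..} b" and "0 < \<tau>"
    and alive: "\<And>t. 0 \<le> t \<Longrightarrow> t < \<tau> \<Longrightarrow> solves b t (glued b)"
    and dead: "\<not> solves b \<tau> (glued b)"
  shows "(glued b \<longlongrightarrow> 0) (at_left \<tau>)"
proof (rule tendstoI)
  fix e :: real assume "e > 0"
  have b\<tau>: "continuous_on {0..\<tau>} b" using b by (rule continuous_on_subset) auto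
  obtain x0 where x0: "0 < x0" "\<And>t x. x0 < x \<Longrightarrow> 0 \<le> t \<Longrightarrow> g t x < 0"
    using negative_above by blast
  have "bounded (b ` {0..\<tau>})"
    using compact_continuous_image[OF b\<tau>] by (intro compact_imp_bounded) simp
  then obtain B where "\<forall>y\<in>b ` {0..\<tau>}. norm y \<le> B" unfolding bounded_iff by blast
  then have B: "\<bar>b t\<bar> \<le> B" if "t \<in> {0..\<tau>}" for t using that by simp
  define N where "N = x0 + 2 * B"
  have upper: "glued b t \<le> N" if "0 \<le> t" "t < \<tau>" for t
    unfolding N_def by (rule solves_upper_bound[OF alive[OF that] x0 B]) (use that in auto)
  have pos: "0 < glued b t" if "0 \<le> t" "t < \<tau>" for t
    using solvesD(2)[OF alive[OF that]] that by simp
  have "compact ((\<lambda>(t, x). g t x) ` ({0..\<tau>} \<times> {e / 2..N}))"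
    by (rule compact_continuous_image[OF continuous_on_subset[OF continuous]])
      (use \<open>e > 0\<close> in \<open>auto intro: compact_Times\<close>)
  then have "bounded ((\<lambda>(t, x). g t x) ` ({0..\<tau>} \<times> {e / 2..N}))"
    by (rule compact_imp_bounded)
  then obtain G where "0 < G" and G': "\<forall>y\<in>(\<lambda>(t, x). g t x) ` ({0..\<tau>} \<times> {e / 2..N}). norm y \<le> G"
    unfolding bounded_pos by blast
  have G: "\<bar>g t x\<bar> \<le> G" if "t \<in> {0..\<tau>}" "x \<in> {e / 2..N}" for t x
  proof -
    have "g t x \<in> (\<lambda>(t, x). g t x) ` ({0..\<tau>} \<times> {e / 2..N})"
      using that by (intro image_eqI[of _ _ "(t, x)"]) auto
    with G' show ?thesis by fastforce
  qed
  have "uniformly_continuous_on {0..\<tau>} b"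
    using b\<tau> by (rule compact_uniformly_continuous) simp
  moreover have "e / 4 > 0" using \<open>e > 0\<close> by simp
  ultimately obtain d where "d > 0"
    and d: "\<And>s t. s \<in> {0..\<tau>} \<Longrightarrow> t \<in> {0..\<tau>} \<Longrightarrow> dist t s < d \<Longrightarrow> dist (b t) (b s) < e / 4"
    unfolding uniformly_continuous_on_def by blast
  \<comment> \<open>Within a time \<open>\<delta>\<close> the driving path and the drift integral each contribute less than \<open>e / 4\<close>.\<close>
  define \<delta> where "\<delta> = min d (e / (4 * G))"
  have "\<delta> > 0" using \<open>d > 0\<close> \<open>e > 0\<close> \<open>G > 0\<close> by (simp add: \<delta>_def)
  have small: "glued b r < e" if r: "0 \<le> r" "\<tau> - \<delta> < r" "r < \<tau>" for r
  proof (rule ccontr)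
    assume "\<not> glued b r < e"
    then have high: "e \<le> glued b r" by simp
    have above: "e / 2 < glued b t" if t: "r \<le> t" "t < \<tau>" for t
    proof (rule ccontr)
      assume low: "\<not> e / 2 < glued b t"
      have sol: "solves b t (glued b)" using t r by (intro alive) auto
      have c: "continuous_on {r..t} (glued b)"
        by (rule continuous_on_subset[OF solvesD(1)[OF sol]]) (use r in auto)
      have "t \<in> {r..t}" "glued b t \<le> e / 2" using t low by auto
      then obtain s where s: "s \<in> {r..t}" "glued b s \<le> e / 2"
        and first: "\<And>u. r \<le> u \<Longrightarrow> u < s \<Longrightarrow> e / 2 < glued b u"
        using first_time_below[OF c] by metis
      have "integral {r..s} (\<lambda>u. - g u (glued b u)) \<le> G * (s - r)"
      proof (rule integral_le_interior_bound)
        show "continuous_on {r..s} (\<lambda>u. - g u (glued b u))"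
          by (intro continuous_on_minus continuous_on_subset[OF continuous_on_drift[OF sol]])
            (use s r in auto)
        fix u assume u: "r < u" "u < s"
        then have "e / 2 < glued b u" using first[of u] by simp
        then have "\<bar>g u (glued b u)\<bar> \<le> G"
          using u s t r upper[of u] by (intro G) auto
        then show "- g u (glued b u) \<le> G" by linarith
      qed (use s in auto)
      moreover have "G * (s - r) < e / 4"
      proof -
        have "s - r < e / (4 * G)" using s t r by (auto simp: \<delta>_def)
        then show ?thesis using \<open>G > 0\<close> by (simp add: field_simps)
      qed
      moreover have "glued b s - glued b r = b s - b r + integral {r..s} (\<lambda>u. g u (glued b u))"
        using s r by (intro solves_increment[OF sol]) auto
      moreover have "dist (b s) (b r) < e / 4"
        using s t r by (intro d) (auto simp: \<delta>_def dist_real_def)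
      ultimately show False
        using s(2) high unfolding integral_neg dist_real_def by linarith
    qed
    have solr: "solves b r (glued b)" using r by (intro alive) auto
    obtain n where n: "\<And>t. t \<in> {0..r} \<Longrightarrow> glued b t \<in> window n"
      using solves_in_window[OF solr] by blast
    obtain m where m: "{e / 2..N} \<subseteq> window m"
      using Icc_subset_window[of "e / 2" N] \<open>e > 0\<close> by auto
    define k where "k = max n m"
    have win: "glued b t \<in> window k" if "0 \<le> t" "t < \<tau>" for t
    proof (cases "t \<le> r")
      case True
      then show ?thesis using n[of t] that window_mono[of n k] by (auto simp: k_def)
    next
      case False
      then have "glued b t \<in> {e / 2..N}" using above[of t] upper[of t] that by auto
      then show ?thesis using m window_mono[of m k] by (auto simp: k_def)
    qed
    have flow: "trunc.flow k b t \<in> window k" if t: "0 \<le> t" "t < \<tau>" for t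
    proof -
      have "glued b t = trunc.flow k b t"
        by (rule solves_eq_trunc_flow[OF b alive[OF t]]) (use t win in auto)
      then show ?thesis using win[OF t] by simp
    qed
    have "continuous_on {0..\<tau>} (trunc.flow k b)"
      using b\<tau> by (rule trunc.continuous_on_flow)
    then have "(trunc.flow k b \<longlongrightarrow> trunc.flow k b \<tau>) (at_left \<tau>)"
      using \<open>0 < \<tau>\<close> by (simp add: continuous_on_Icc_at_leftD)
    then have "trunc.flow k b \<tau> \<in> window k"
    proof (rule Lim_in_closed_set[OF closed_window, rotated 2])
      show "\<forall>\<^sub>F t in at_left \<tau>. trunc.flow k b t \<in> window k"
        by (rule eventually_at_leftI[of 0]) (use flow \<open>0 < \<tau>\<close> in auto)
    qed simp
    then have "trunc.flow k b t \<in> window k" if "t \<in> {0..\<tau>}" for t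
      using flow[of t] that by (cases "t = \<tau>") auto
    then have "solves b \<tau> (glued b)"
      using solves_glued[OF b trunc_flow_solves[OF b]] by blast
    with dead show False ..
  qed
  show "\<forall>\<^sub>F t in at_left \<tau>. dist (glued b t) 0 < e"
  proof (rule eventually_at_leftI)
    show "max 0 (\<tau> - \<delta>) < \<tau>" using \<open>0 < \<tau>\<close> \<open>\<delta> > 0\<close> by simp
    fix t assume "t \<in> {max 0 (\<tau> - \<delta>)<..<\<tau>}"
    then show "dist (glued b t) 0 < e"
      using small[of t] pos[of t] by (simp add: dist_real_def)
  qed
qed

end

section \<open>First visit to zero\<close>

lemma first_visit_le: "0 < t \<Longrightarrow> z t = 0 \<Longrightarrow> first_visit z \<le> ereal t"
  unfolding first_visit_def by (intro Inf_lower) auto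

lemma first_visit_ge: "(\<And>t. 0 < t \<Longrightarrow> z t = 0 \<Longrightarrow> c \<le> ereal t) \<Longrightarrow> c \<le> first_visit z"
  unfolding first_visit_def by (intro Inf_greatest) auto

lemma first_visit_nonneg: "0 \<le> first_visit z"
  by (rule first_visit_ge) simp

lemma nonzero_before_first_visit: "0 < t \<Longrightarrow> ereal t < first_visit z \<Longrightarrow> z t \<noteq> 0"
  using first_visit_le[of t z] by (auto simp: not_le[symmetric])

context singular_drift
begin

lemma solves_0: "0 < b 0 \<Longrightarrow> solves b 0 b"
  by (simp add: solves_def)

text \<open>The set of times up to which a solution exists is relatively open, and beyond it the glued path vanishes;
hence its first visit to \<open>0\<close> is exactly the end of the life time of the maximal solution.\<close>

lemma less_first_visit_glued_iff:
  assumes b: "continuous_on {0..} b" and "0 < b 0" and "0 \<le> t"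
  shows "ereal t < first_visit (glued b) \<longleftrightarrow> solves b t (glued b)"
proof
  assume "solves b t (glued b)"
  from solves_extend[OF b this \<open>0 \<le> t\<close>]
  obtain T where "t < T" and sol: "solves b T (glued b)" by blast
  have "ereal T \<le> first_visit (glued b)"
  proof (rule first_visit_ge)
    fix s :: real assume "0 < s" "glued b s = 0"
    then show "ereal T \<le> ereal s"
      using solvesD(2)[OF sol, of s] by (cases "s \<le> T") auto
  qed
  moreover have "ereal t < ereal T" using \<open>t < T\<close> by simp
  ultimately show "ereal t < first_visit (glued b)" by (rule less_le_trans[rotated])
next
  assume less: "ereal t < first_visit (glued b)"
  show "solves b t (glued b)"
  proof (rule ccontr)
    assume dead: "\<not> solves b t (glued b)"
    have "solves b 0 (glued b)"
      by (rule solves_glued[OF b solves_0]) fact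
    with dead \<open>0 \<le> t\<close> have "0 < t" by (cases "t = 0") auto
    with less nonzero_before_first_visit glued_eq_0[OF b dead] show False by blast
  qed
qed

lemma glued_at_first_visit:
  assumes b: "continuous_on {0..} b" and "0 < b 0" and t: "ereal t = first_visit (glued b)"
  shows "0 < t" "\<not> solves b t (glued b)" "glued b t = 0"
proof -
  have "0 \<le> t" using first_visit_nonneg[of "glued b"] t[symmetric] by simp
  then show dead: "\<not> solves b t (glued b)"
    using less_first_visit_glued_iff[OF b \<open>0 < b 0\<close>] t by (metis less_irrefl)
  have "solves b 0 (glued b)"
    by (rule solves_glued[OF b solves_0]) fact
  with dead \<open>0 \<le> t\<close> show "0 < t" by (cases "t = 0") auto
  show "glued b t = 0" using b dead by (rule glued_eq_0)
qed

lemma continuous_on_glued: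
  assumes b: "continuous_on {0..} b" and "0 < b 0"
  shows "continuous_on {t. 0 \<le> t \<and> ereal t \<le> first_visit (glued b)} (glued b)"
    (is "continuous_on ?I _")
  unfolding continuous_on_def
proof
  fix t assume t: "t \<in> ?I"
  then have "0 \<le> t" by simp
  show "(glued b \<longlongrightarrow> glued b t) (at t within ?I)"
  proof (cases "solves b t (glued b)")
    case True
    obtain T where "t < T" and sol: "solves b T (glued b)"
      using solves_extend[OF b True \<open>0 \<le> t\<close>] by blast
    have "(glued b \<longlongrightarrow> glued b t) (at t within {0..T})"
      using solvesD(1)[OF sol] \<open>0 \<le> t\<close> \<open>t < T\<close> by (simp add: continuous_on_def)
    moreover have "at t within ({0..} \<inter> {..<T}) = at t within {0..T}"
      using \<open>t < T\<close> by (intro at_within_nhd[of _ "{..<T}"]) auto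
    moreover have "at t within ({0..} \<inter> {..<T}) = at t within {0..}"
      using \<open>t < T\<close> by (intro at_within_nhd[of _ "{..<T}"]) auto
    ultimately have "(glued b \<longlongrightarrow> glued b t) (at t within {0..})" by simp
    then show ?thesis by (rule tendsto_within_subset) auto
  next
    case False
    then have eq: "ereal t = first_visit (glued b)"
      using t less_first_visit_glued_iff[OF b \<open>0 < b 0\<close> \<open>0 \<le> t\<close>] by auto
    note end_point = glued_at_first_visit[OF b \<open>0 < b 0\<close> eq]
    have "(glued b \<longlongrightarrow> 0) (at_left t)"
    proof (rule glued_tendsto_0[OF b \<open>0 < t\<close> _ False])
      fix s assume "0 \<le> s" "s < t"
      then show "solves b s (glued b)"
        using less_first_visit_glued_iff[OF b \<open>0 < b 0\<close>] eq[symmetric] by simp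
    qed
    moreover have "at t within ?I \<le> at t within {..t}"
      using eq[symmetric] by (intro at_le) auto
    moreover have "at t within {..t} = at_left t"
    proof -
      have "{..t} - {t} = {..<t}" "{..<t} - {t} = {..<t}" by auto
      then show ?thesis by (simp only: at_within_def)
    qed
    ultimately have "(glued b \<longlongrightarrow> 0) (at t within ?I)" by (simp only: tendsto_mono)
    then show ?thesis using end_point(3) by simp
  qed
qed

end

section \<open>Paths of the stochastic differential equation\<close>

text \<open>On a compact box the continuous partial derivative is bounded, and the mean value theorem turns this bound
into a Lipschitz constant.\<close>

lemma singular_drift_of_condition_D1:
  assumes "condition_D1 f"
  shows "singular_drift (\<lambda>t x. f t x / (2 * x))"
proof
  let ?g = "\<lambda>t x. f t x / (2 * x)"
  show "continuous_on ({0..} \<times> {0<..}) (\<lambda>(t, x). ?g t x)"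
    using assms unfolding condition_D1_def Let_def by blast
  show "\<exists>x0>0. \<forall>x>x0. \<forall>t\<ge>0. ?g t x < 0"
    using assms unfolding condition_D1_def Let_def by blast
  obtain g' where deriv: "\<And>t x. 0 \<le> t \<Longrightarrow> 0 < x \<Longrightarrow> (?g t has_real_derivative g' t x) (at x)"
    and cont: "continuous_on ({0..} \<times> {0<..}) (\<lambda>(t, x). g' t x)"
    using assms unfolding condition_D1_def Let_def by blast
  fix T a c :: real assume "0 < a"
  have "compact ((\<lambda>(t, x). g' t x) ` ({0..T} \<times> {a..c}))"
    by (rule compact_continuous_image[OF continuous_on_subset[OF cont]])
      (use \<open>0 < a\<close> in \<open>auto intro: compact_Times\<close>)
  then have "bounded ((\<lambda>(t, x). g' t x) ` ({0..T} \<times> {a..c}))"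
    by (rule compact_imp_bounded)
  then obtain L where "0 < L" and L': "\<forall>y\<in>(\<lambda>(t, x). g' t x) ` ({0..T} \<times> {a..c}). norm y \<le> L"
    unfolding bounded_pos by blast
  have L: "norm (g' t x) \<le> L" if "t \<in> {0..T}" "x \<in> {a..c}" for t x
  proof -
    have "g' t x \<in> (\<lambda>(t, x). g' t x) ` ({0..T} \<times> {a..c})"
      using that by (intro image_eqI[of _ _ "(t, x)"]) auto
    then show ?thesis by (rule bspec[OF L'])
  qed
  show "\<exists>L>0. \<forall>t\<in>{0..T}. \<forall>x\<in>{a..c}. \<forall>y\<in>{a..c}. \<bar>?g t x - ?g t y\<bar> \<le> L * \<bar>x - y\<bar>"
  proof (intro exI[of _ L] conjI ballI \<open>0 < L\<close>)
    fix t x y assume t: "t \<in> {0..T}" and xy: "x \<in> {a..c}" "y \<in> {a..c}"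
    have "norm (?g t x - ?g t y) \<le> L * norm (x - y)"
    proof (rule field_differentiable_bound[OF convex_real_interval(5)])
      fix u assume u: "u \<in> {a..c}"
      show "(?g t has_field_derivative g' t u) (at u within {a..c})"
        by (rule has_field_derivative_at_within[OF deriv]) (use t u \<open>0 < a\<close> in auto)
      show "norm (g' t u) \<le> L" using L[OF t u] .
    qed (use xy in auto)
    then show "\<bar>?g t x - ?g t y\<bar> \<le> L * \<bar>x - y\<bar>" by simp
  qed
qed

locale sde_path =
  fixes f :: "real \<Rightarrow> real \<Rightarrow> real" and \<sigma> z0 :: real and w :: "real \<Rightarrow> real"
  assumes condition_D1: "condition_D1 f" and z0_pos: "0 < z0"
    and continuous_path: "continuous_on {0..} w" and path_0: "w 0 = 0"
begin

sublocale singular_drift "\<lambda>t x. f t x / (2 * x)"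
  using condition_D1 by (rule singular_drift_of_condition_D1)

abbreviation driver :: "real \<Rightarrow> real" where
  "driver \<equiv> \<lambda>t. z0 + \<sigma> / 2 * w t"

lemma driver_path: "continuous_on {0..} driver" "0 < driver 0"
  using continuous_path path_0 z0_pos by (auto intro!: continuous_intros)

lemma path_drift_integral:
  assumes c: "continuous_on {0..T} z" and pos: "\<And>t. t \<in> {0..T} \<Longrightarrow> 0 < z t" and t: "t \<in> {0..T}"
  shows "set_integrable lborel {0..t} (\<lambda>s. f s (z s) / z s)"
    and "(1/2) * (LINT s:{0..t}|lborel. f s (z s) / z s)
           = integral {0..t} (\<lambda>s. f s (z s) / (2 * z s))"
proof -
  have "continuous_on {0..t} (\<lambda>s. (\<lambda>(t, x). f t x / (2 * x)) (s, z s))"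
    by (rule continuous_on_compose2[OF continuous])
      (use t pos in \<open>auto intro!: continuous_on_Pair continuous_on_id continuous_on_subset[OF c]\<close>)
  then have "continuous_on {0..t} (\<lambda>s. 2 * (f s (z s) / (2 * z s)))"
    by (intro continuous_on_mult continuous_on_const) simp
  then have "continuous_on {0..t} (\<lambda>s. f s (z s) / z s)" by simp
  then show int: "set_integrable lborel {0..t} (\<lambda>s. f s (z s) / z s)"
    by (rule borel_integrable_atLeastAtMost')
  have "(LINT s:{0..t}|lborel. f s (z s) / z s) = integral {0..t} (\<lambda>s. f s (z s) / z s)"
    by (rule set_borel_integral_eq_integral[OF int])
  also have "(\<lambda>s. f s (z s) / z s) = (\<lambda>s. 2 * (f s (z s) / (2 * z s)))" by simp
  also have "integral {0..t} \<dots> = 2 * integral {0..t} (\<lambda>s. f s (z s) / (2 * z s))"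
    by (rule integral_mult_right)
  finally show "(1/2) * (LINT s:{0..t}|lborel. f s (z s) / z s)
           = integral {0..t} (\<lambda>s. f s (z s) / (2 * z s))" by simp
qed

lemma glued_pos:
  assumes "0 \<le> t" "ereal t < first_visit (glued driver)"
  shows "0 < glued driver t"
  using assms less_first_visit_glued_iff[OF driver_path] solvesD(2) by simp

lemma solution_path_glued: "solution_path f \<sigma> z0 w (glued driver)"
  unfolding solution_path_def
proof (intro conjI allI impI)
  show "glued driver 0 = z0"
    using glued_eq[OF driver_path(1) solves_0[of driver, OF driver_path(2)], of 0] path_0 by simp
  show "continuous_on {t. 0 \<le> t \<and> ereal t \<le> first_visit (glued driver)} (glued driver)"
    by (rule continuous_on_glued[OF driver_path])
  show "glued driver t = 0" if "ereal t = first_visit (glued driver)" for t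
    using glued_at_first_visit(3)[OF driver_path that] .
  fix t assume "0 \<le> t \<and> ereal t < first_visit (glued driver)"
  then have t: "t \<in> {0..t}" and sol: "solves driver t (glued driver)"
    using less_first_visit_glued_iff[OF driver_path, of t] by auto
  note eq = path_drift_integral[OF solvesD(1,2)[OF sol] t]
  show "set_integrable lborel {0..t} (\<lambda>s. f s (glued driver s) / glued driver s)"
    using eq(1) .
  have *: "x = a + y + i \<Longrightarrow> j = i \<Longrightarrow> x = a + j + y" for x a y i j :: real by simp
  show "glued driver t = z0 + (1/2) * (LINT s:{0..t}|lborel. f s (glued driver s) / glued driver s)
          + (\<sigma>/2) * w t"
    by (rule *[OF solvesD(3)[OF sol t] eq(2)])
qed

text \<open>Before its own first visit to \<open>0\<close> any solution is positive and hence equals the glued path. It can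
reach \<open>0\<close> no later than the glued path, because the latter is maximal, and no earlier, because by
continuity the two still agree at that time, where the glued path would be positive.\<close>

lemma solution_path_unique:
  assumes z: "solution_path f \<sigma> z0 w z"
  shows "first_visit z = first_visit (glued driver)"
    and "\<And>t. 0 \<le> t \<Longrightarrow> ereal t \<le> first_visit (glued driver) \<Longrightarrow> z t = glued driver t"
proof -
  let ?I = "{t. 0 \<le> t \<and> ereal t \<le> first_visit z}"
  have z_0: "z 0 = z0" and cont: "continuous_on ?I z"
    and zero: "\<And>t. ereal t = first_visit z \<Longrightarrow> z t = 0"
    and eq: "\<And>t. 0 \<le> t \<Longrightarrow> ereal t < first_visit z \<Longrightarrow>
        z t = z0 + (1/2) * (LINT s:{0..t}|lborel. f s (z s) / z s) + (\<sigma>/2) * w t"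
    using z unfolding solution_path_def by blast+
  have sub: "{0..t} \<subseteq> ?I" if "ereal t \<le> first_visit z" for t
    using that by (auto intro: order_trans[of _ "ereal t"])
  have pos: "0 < z t" if t: "0 \<le> t" "ereal t < first_visit z" for t
  proof (rule ccontr)
    assume "\<not> 0 < z t"
    moreover have "continuous_on {0..t} z"
      using t by (intro continuous_on_subset[OF cont] sub) simp
    ultimately obtain s where s: "0 \<le> s" "s \<le> t" "z s = 0"
      using IVT2'[of z t 0 0] z_0 z0_pos t by auto
    then have "0 < s" using z_0 z0_pos by (cases "s = 0") auto
    moreover have "ereal s < first_visit z" using s t by (metis ereal_less_eq(3) le_less_trans)
    ultimately show False using nonzero_before_first_visit s by blast
  qed
  have sol: "solves driver t z" if t: "0 \<le> t" "ereal t < first_visit z" for t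
    unfolding solves_def
  proof (intro conjI ballI)
    show c: "continuous_on {0..t} z"
      using t by (intro continuous_on_subset[OF cont] sub) simp
    have before: "ereal s < first_visit z" if "s \<in> {0..t}" for s
      using that t by (metis atLeastAtMost_iff ereal_less_eq(3) le_less_trans)
    then have p: "\<And>s. s \<in> {0..t} \<Longrightarrow> 0 < z s" using pos by auto
    fix s assume s: "s \<in> {0..t}"
    show "0 < z s" using p[OF s] .
    show "z s = driver s + integral {0..s} (\<lambda>r. f r (z r) / (2 * z r))"
      using path_drift_integral(2)[OF c p s] eq[of s] before[OF s] s by simp
  qed
  have agree: "z t = glued driver t" if "0 \<le> t" "ereal t < first_visit z" for t
    using glued_eq[OF driver_path(1) sol[OF that], of t] that by simp
  have le: "first_visit z \<le> first_visit (glued driver)"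
  proof (rule ccontr)
    assume "\<not> first_visit z \<le> first_visit (glued driver)"
    then have less: "first_visit (glued driver) < first_visit z" by simp
    then obtain t where t: "ereal t = first_visit (glued driver)"
      using first_visit_nonneg[of "glued driver"] by (cases "first_visit (glued driver)") auto
    note end_point = glued_at_first_visit[OF driver_path t]
    have "solves driver t z" using sol[of t] end_point less t by simp
    then show False using end_point solves_glued[OF driver_path(1)] by blast
  qed
  show fv: "first_visit z = first_visit (glued driver)"
  proof (rule ccontr)
    assume "first_visit z \<noteq> first_visit (glued driver)"
    with le have less: "first_visit z < first_visit (glued driver)" by simp
    then obtain t where t: "ereal t = first_visit z"
      using first_visit_nonneg[of z] by (cases "first_visit z") auto
    have "0 \<le> t" using first_visit_nonneg[of z] t[symmetric] by simp
    moreover have "t \<noteq> 0" using zero[OF t] z_0 z0_pos by auto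
    ultimately have "0 < t" by simp
    have "solves driver t (glued driver)"
      using less_first_visit_glued_iff[OF driver_path \<open>0 \<le> t\<close>] less t by simp
    note sol_t = solvesD[OF this]
    have "continuous_on {0..t} z"
      by (rule continuous_on_subset[OF cont sub]) (simp add: t)
    then have lim_z: "(z \<longlongrightarrow> z t) (at_left t)"
      using \<open>0 < t\<close> by (rule continuous_on_Icc_at_leftD)
    have lim_glued: "(glued driver \<longlongrightarrow> glued driver t) (at_left t)"
      using sol_t(1) \<open>0 < t\<close> by (rule continuous_on_Icc_at_leftD)
    have "\<forall>\<^sub>F s in at_left t. z s = glued driver s"
    proof (rule eventually_at_leftI[OF _ \<open>0 < t\<close>])
      fix s assume "s \<in> {0<..<t}"
      then show "z s = glued driver s" using t[symmetric] by (intro agree) auto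
    qed
    from tendsto_cong[OF this] lim_glued
    have "(z \<longlongrightarrow> glued driver t) (at_left t)" by (rule iffD2)
    from tendsto_unique[OF _ lim_z this] have "z t = glued driver t" by simp
    then show False using zero[OF t] sol_t(2)[of t] \<open>0 \<le> t\<close> by simp
  qed
  show "z t = glued driver t" if "0 \<le> t" "ereal t \<le> first_visit (glued driver)" for t
  proof (cases "ereal t = first_visit z")
    case True
    then have "ereal t = first_visit (glued driver)" by (simp only: fv)
    from glued_at_first_visit(3)[OF driver_path this] show ?thesis by (simp only: zero[OF True])
  next
    case False
    then have "ereal t < first_visit z" using that(2) fv by simp
    with that(1) show ?thesis by (rule agree)
  qed
qed

end

section \<open>Existence and uniqueness\<close>

theorem theorem2p1:
  fixes M :: "'a measure" and W :: "real \<Rightarrow> 'a \<Rightarrow> real"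
    and f :: "real \<Rightarrow> real \<Rightarrow> real" and H \<sigma> z0 :: real
  assumes "prob_space M"
    and "0 < H" and "H < 1"
    and "\<sigma> > 0" and "z0 > 0"
    and "fractional_brownian_motion M H W"
    and "continuous_on ({0..} \<times> {0..}) (\<lambda>(t, x). f t x)"
    and "condition_D1 f"
  shows "\<exists>Z. sde_solution M f \<sigma> z0 W Z \<and>
           (AE \<omega> in M. \<forall>t\<ge>0. ereal t < first_visit (\<lambda>t. Z t \<omega>) \<longrightarrow> Z t \<omega> > 0) \<and>
           (\<forall>Z'. sde_solution M f \<sigma> z0 W Z' \<longrightarrow>
              (AE \<omega> in M. first_visit (\<lambda>t. Z' t \<omega>) = first_visit (\<lambda>t. Z t \<omega>) \<and>
                 (\<forall>t\<ge>0. ereal t \<le> first_visit (\<lambda>t. Z t \<omega>) \<longrightarrow> Z' t \<omega> = Z t \<omega>)))"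
proof -
  interpret singular_drift "\<lambda>t x. f t x / (2 * x)"
    using assms(8) by (rule singular_drift_of_condition_D1)
  have W_meas: "W t \<in> borel_measurable M" if "0 \<le> t" for t
  proof -
    have "gaussian_process M {0..} W"
      using assms(6) unfolding fractional_brownian_motion_def by blast
    then have "gaussian_rv M (\<lambda>\<omega>. \<Sum>s\<in>{t}. 1 * W s \<omega>)"
      unfolding gaussian_process_def using that
      by (elim allE[of _ "{t}"] allE[of _ "\<lambda>_. 1"]) auto
    then show ?thesis unfolding gaussian_rv_def by simp
  qed
  have "AE \<omega> in M. W 0 \<omega> = 0" "AE \<omega> in M. continuous_on {0..} (\<lambda>t. W t \<omega>)"
    using assms(6) unfolding fractional_brownian_motion_def by blast+
  then have "AE \<omega> in M. W 0 \<omega> = 0 \<and> continuous_on {0..} (\<lambda>t. W t \<omega>)" by simp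
  then obtain N where N: "N \<in> null_sets M"
    and good: "\<And>\<omega>. \<omega> \<in> space M - N \<Longrightarrow> W 0 \<omega> = 0 \<and> continuous_on {0..} (\<lambda>t. W t \<omega>)"
    by (rule AE_E3) blast
  \<comment> \<open>On the null set \<open>N\<close> the path is replaced by \<open>0\<close>: the construction then applies to every outcome, and since \<open>N\<close> is measurable so is the result, although \<open>M\<close> need not be complete.\<close>
  define V where "V t \<omega> = (if \<omega> \<in> space M - N then W t \<omega> else 0)" for t \<omega>
  have V_eq: "(\<lambda>t. V t \<omega>) = (\<lambda>t. W t \<omega>)" if "\<omega> \<in> space M - N" for \<omega>
    using that by (simp add: V_def)
  have V0: "V 0 \<omega> = 0" for \<omega>
    using good[of \<omega>] unfolding V_def by (cases "\<omega> \<in> space M - N") (auto split: if_splits)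
  have V_cont: "continuous_on {0..} (\<lambda>t. V t \<omega>)" for \<omega>
  proof (cases "\<omega> \<in> space M - N")
    case True
    from V_eq[OF True] show ?thesis using good[OF True] by (simp only:)
  next
    case False
    then have "(\<lambda>t. V t \<omega>) = (\<lambda>t. 0)" by (auto simp: V_def)
    then show ?thesis by (simp only: continuous_on_const)
  qed
  have V_meas: "V t \<in> borel_measurable M" if "0 \<le> t" for t
    unfolding V_def using N by (intro measurable_If_set W_meas that) (auto dest: null_setsD2)
  interpret path: sde_path f \<sigma> z0 "\<lambda>t. V t \<omega>" for \<omega>
    by unfold_locales (rule assms(8) assms(5) V_cont V0)+
  define Z where "Z t \<omega> = glued (\<lambda>t. z0 + \<sigma> / 2 * V t \<omega>) t" for t \<omega>
  have Z_eq: "(\<lambda>t. Z t \<omega>) = glued (\<lambda>t. z0 + \<sigma> / 2 * V t \<omega>)" for \<omega>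
    by (simp add: Z_def fun_eq_iff)
  have almost: "AE \<omega> in M. \<omega> \<in> space M - N"
    using AE_not_in[OF N] AE_space by eventually_elim simp
  show ?thesis
  proof (intro exI[of _ Z] conjI allI impI)
    show "sde_solution M f \<sigma> z0 W Z"
      unfolding sde_solution_def
    proof (intro conjI allI impI)
      show "Z t \<in> borel_measurable M" if "0 \<le> t" for t
        unfolding Z_def
        by (rule borel_measurable_glued[OF _ _ that])
          (intro borel_measurable_add borel_measurable_times borel_measurable_const V_meas
             continuous_on_add continuous_on_mult continuous_on_const V_cont, assumption?)+
      show "AE \<omega> in M. solution_path f \<sigma> z0 (\<lambda>t. W t \<omega>) (\<lambda>t. Z t \<omega>)"
        using almost
      proof eventually_elim
        case (elim \<omega>)
        show ?case using path.solution_path_glued[of \<omega>] unfolding Z_eq V_eq[OF elim] .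
      qed
    qed
    show "AE \<omega> in M. \<forall>t\<ge>0. ereal t < first_visit (\<lambda>t. Z t \<omega>) \<longrightarrow> Z t \<omega> > 0"
      using path.glued_pos by (intro AE_I2) (auto simp: Z_eq Z_def)
    fix Z' assume "sde_solution M f \<sigma> z0 W Z'"
    then have "AE \<omega> in M. solution_path f \<sigma> z0 (\<lambda>t. W t \<omega>) (\<lambda>t. Z' t \<omega>)"
      unfolding sde_solution_def by blast
    with almost
    show "AE \<omega> in M. first_visit (\<lambda>t. Z' t \<omega>) = first_visit (\<lambda>t. Z t \<omega>) \<and>
            (\<forall>t\<ge>0. ereal t \<le> first_visit (\<lambda>t. Z t \<omega>) \<longrightarrow> Z' t \<omega> = Z t \<omega>)"
    proof eventually_elim
      case (elim \<omega>)
      then have "solution_path f \<sigma> z0 (\<lambda>t. V t \<omega>) (\<lambda>t. Z' t \<omega>)" by (simp only: V_eq)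
      from path.solution_path_unique[OF this] show ?case by (simp add: Z_eq Z_def)
    qed
  qed
qed

end
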